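(* Let $n \ge 4$ be an integer and let $\tau = \lfloor \frac{n}{2} \rfloor$. Then: 1. the graph $(C_n^{\tau})^c$ is singular if and only if $n$ is even or $n \equiv 3 \pmod 6$; 2. for every $i$ with $1 \le i < \tau$, the graph $(C_n^i)^c$ is singular if and only if $3 \mid n$ and $\gcd(i,n)$ divides $\frac{n}{3}$.
   Context: A graph is called singular if its adjacency matrix is singular. $C_n$ denotes the cycle graph on $n$ vertices. For $1 \le i \le \lfloor n/2 \rfloor$, $C_n^i$ is the graph on the vertex set of $C_n$ in which two vertices are adjacent exactly when their distance in $C_n$ equals $i$. The complement $X^c$ of a graph $X$ has the same vertex set, and two distinct vertices are adjacent in $X^c$ exactly when they are not adjacent in $X$ (no loops). *)

theory Defs
  imports
    "Graph_Theory.Pair_Digraph"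
    "Graph_Theory.Shortest_Path"
    "Jordan_Normal_Form.Determinant"
begin

text \<open>
  Finite simple graphs are rendered as \<open>pair_graph\<close>s, i.e. finite loop-free symmetric
  digraphs without parallel arcs: an undirected edge is the pair of its two orientations.
\<close>

text \<open>Intended for \<open>n \<ge> 3\<close>.\<close>

definition cycle_graph :: "nat \<Rightarrow> nat pair_pre_digraph" where
  "cycle_graph n =
    \<lparr> pverts = {0..<n},
      parcs = {(u, v). u < n \<and> v < n \<and> (v = (u + 1) mod n \<or> u = (v + 1) mod n)} \<rparr>"

lemma pair_graph_cycle_graph:
  assumes "n \<ge> 2"
  shows "pair_graph (cycle_graph n)"
proof -
  have *: "u \<noteq> Suc u mod n" if "u < n" for u
    using that assms by (cases "Suc u = n") auto
  have "parcs (cycle_graph n) \<subseteq> {0..<n} \<times> {0..<n}"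
    by (auto simp: cycle_graph_def)
  then have "finite (parcs (cycle_graph n))"
    by (rule finite_subset) simp
  then show ?thesis
    by unfold_locales (auto simp: cycle_graph_def symmetric_def sym_def dest: *)
qed

text \<open>
  The distance between two vertices is the infimum of the costs of the walks joining them,
  where every arc has cost 1 (and is thus \<open>\<infinity>\<close> if there is no such walk). The library constant
  \<open>\<mu>\<close> can be unfolded only for well-formed digraphs, among them the cycles by the lemma above.
\<close>

definition graph_distance :: "'a pair_pre_digraph \<Rightarrow> 'a \<Rightarrow> 'a \<Rightarrow> ereal" where
  "graph_distance G u v = wf_digraph.\<mu> (with_proj G) (\<lambda>_. 1) u v"

text \<open>With \<open>G = cycle_graph n\<close> this is the graph $C_n^i$. It has no loops provided \<open>i \<ge> 1\<close>.\<close>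

definition distance_graph :: "'a pair_pre_digraph \<Rightarrow> nat \<Rightarrow> 'a pair_pre_digraph" where
  "distance_graph G i =
    \<lparr> pverts = pverts G,
      parcs = {(u, v). u \<in> pverts G \<and> v \<in> pverts G \<and> graph_distance G u v = ereal (real i)} \<rparr>"

definition graph_complement :: "'a pair_pre_digraph \<Rightarrow> 'a pair_pre_digraph" where
  "graph_complement G =
    \<lparr> pverts = pverts G,
      parcs = {(u, v). u \<in> pverts G \<and> v \<in> pverts G \<and> u \<noteq> v \<and> (u, v) \<notin> parcs G} \<rparr>"

text \<open>
  Rows and columns are indexed by the vertices in increasing order; another enumeration of the
  vertices conjugates the matrix by a permutation matrix, which does not affect singularity.
\<close>

definition adjacency_matrix :: "'a::linorder pair_pre_digraph \<Rightarrow> real mat" where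
  "adjacency_matrix G =
    (let vs = sorted_list_of_set (pverts G); n = length vs
     in mat n n (\<lambda>(i, j). if (vs ! i, vs ! j) \<in> parcs G then 1 else 0))"

definition singular_graph :: "'a::linorder pair_pre_digraph \<Rightarrow> bool" where
  "singular_graph G \<longleftrightarrow> det (adjacency_matrix G) = 0"

end

theory Submission
  imports Defs "HOL-Number_Theory.Cong"
begin

text \<open>
  The complement of \<open>C\<^sub>n\<^sup>i\<close> is singular iff some nonzero \<open>n\<close>-periodic \<open>f\<close> on the integers satisfies
  \<open>S = f x + f (x + i) + f (x - i)\<close> for all \<open>x\<close>, where \<open>S\<close> is the sum of \<open>f\<close> over a period
  (for \<open>2 i = n\<close> the last two terms coincide and count once). Summing over \<open>x\<close> gives
  \<open>n S = 3 S\<close>, so \<open>S = 0\<close>; the resulting recurrence makes \<open>f\<close> also \<open>3 i\<close>-periodic, hence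
  \<open>gcd (3 i) n\<close>-periodic. Unless \<open>3 gcd i n\<close> divides \<open>n\<close>, this gcd divides \<open>i\<close>, and then
  \<open>3 f x = 0\<close>. If \<open>3 g\<close> divides \<open>n\<close> for \<open>g = gcd i n\<close>, the function with values \<open>1\<close>, \<open>-1\<close>
  on the residues \<open>0\<close>, \<open>g\<close> modulo \<open>3 g\<close> and \<open>0\<close> elsewhere is a solution.
\<close>

subsection \<open>Distances in cycles\<close>

lemma cycle_graph_arc_cong:
  assumes "(u, v) \<in> parcs (cycle_graph n)"
  shows "\<exists>s::int. \<bar>s\<bar> = 1 \<and> [int v = int u + s] (mod int n)"
proof -
  from assms have "v = (u + 1) mod n \<or> u = (v + 1) mod n"
    by (simp add: cycle_graph_def)
  then show ?thesis
  proof
    assume "v = (u + 1) mod n"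
    then have "[int v = int u + 1] (mod int n)"
      by (simp add: cong_def zmod_int add.commute)
    then show ?thesis by (intro exI[of _ 1]) simp
  next
    assume "u = (v + 1) mod n"
    then have "[int u = int v + 1] (mod int n)"
      by (simp add: cong_def zmod_int add.commute)
    then have "[int v = int u + (-1)] (mod int n)"
      by (simp add: cong_iff_dvd_diff algebra_simps dvd_diff_commute)
    then show ?thesis by (intro exI[of _ "-1"]) simp
  qed
qed

text \<open>Each arc moves by 1 or -1 modulo \<open>n\<close>, so the net displacement
  \<open>k\<close> is at most the number of arcs. This yields the lower bound on distances.\<close>

lemma cycle_graph_awalk_cong:
  assumes "n \<ge> 2" and "pre_digraph.awalk (cycle_graph n) u p v"
  shows "\<exists>k::int. \<bar>k\<bar> \<le> int (length p) \<and> [int v = int u + k] (mod int n)"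
proof -
  interpret pair_graph "cycle_graph n" by (rule pair_graph_cycle_graph) fact
  from assms(2) show ?thesis
  proof (induction p arbitrary: u)
    case Nil
    then show ?case by (auto simp: awalk_Nil_iff)
  next
    case (Cons e p)
    then have e: "(u, snd e) \<in> parcs (cycle_graph n)" and w: "awalk (snd e) p v"
      by (auto simp: awalk_Cons_iff)
    from Cons.IH[OF w] obtain k :: int
      where k: "\<bar>k\<bar> \<le> int (length p)" "[int v = int (snd e) + k] (mod int n)" by blast
    from cycle_graph_arc_cong[OF e] obtain s :: int
      where s: "\<bar>s\<bar> = 1" "[int (snd e) = int u + s] (mod int n)" by blast
    have "[int v = int u + s + k] (mod int n)"
      using k(2) cong_add[OF s(2) cong_refl[of k]] by (rule cong_trans)
    then show ?case using k(1) s(1)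
      by (intro exI[of _ "s + k"]) (auto simp: add.assoc)
  qed
qed

text \<open>Walking \<open>k\<close> steps in the constant direction \<open>s\<close> yields the
  upper bound on distances. The end vertex is reduced over the integers because \<open>s\<close> may
  be negative.\<close>

lemma cycle_graph_awalk_exists:
  assumes "n \<ge> 2" "u < n" and s: "s = 1 \<or> s = (-1::int)"
  shows "\<exists>p. pre_digraph.awalk (cycle_graph n) u p (nat ((int u + s * int k) mod int n))
           \<and> length p = k"
proof -
  interpret pair_graph "cycle_graph n" by (rule pair_graph_cycle_graph) fact
  have arc: "(w, nat ((int w + s) mod int n)) \<in> parcs (cycle_graph n)" if "w < n" for w
    using s
  proof
    assume "s = 1"
    then have "nat ((int w + s) mod int n) = (w + 1) mod n"
      by (metis nat_int of_nat_1 of_nat_add zmod_int)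
    with that assms(1) show ?thesis by (simp add: cycle_graph_def)
  next
    assume s: "s = -1"
    define v where "v = nat ((int w + s) mod int n)"
    have iv: "int v = (int w - 1) mod int n" using assms(1) s by (simp add: v_def)
    have "int ((v + 1) mod n) = ((int w - 1) mod int n + 1) mod int n"
      by (simp add: zmod_int iv add.commute)
    also have "\<dots> = int w" using that by (simp add: mod_add_left_eq)
    finally have "w = (v + 1) mod n" by simp
    moreover have "v < n" using assms(1) iv
      by (metis not_numeral_le_zero of_nat_0_less_iff of_nat_less_iff pos_mod_bound
          bot_nat_0.not_eq_extremum)
    ultimately show ?thesis using that by (simp add: cycle_graph_def v_def)
  qed
  show ?thesis
  proof (induction k)
    case 0
    have "u \<in> pverts (cycle_graph n)" using assms by (simp add: cycle_graph_def)
    then show ?case using assms by (auto simp: awalk_Nil_iff)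
  next
    case (Suc k)
    define w where "w = nat ((int u + s * int k) mod int n)"
    from Suc obtain p where p: "awalk u p w" "length p = k" by (auto simp: w_def)
    have iw: "int w = (int u + s * int k) mod int n" using assms(1) by (simp add: w_def)
    have "w \<in> pverts (cycle_graph n)" using awalk_last_in_verts[OF p(1)] by simp
    then have wn: "w < n" by (simp add: cycle_graph_def)
    have "(int w + s) mod int n = (int u + s * int (Suc k)) mod int n"
      unfolding iw by (simp add: mod_simps algebra_simps)
    with arc[OF wn]
    have a: "(w, nat ((int u + s * int (Suc k)) mod int n)) \<in> parcs (cycle_graph n)" by simp
    have "awalk w [(w, nat ((int u + s * int (Suc k)) mod int n))]
        (nat ((int u + s * int (Suc k)) mod int n))"
      using arc_implies_awalk a by fastforce
    from awalk_appendI[OF p(1) this] p(2) show ?case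
      by (intro exI[of _ "p @ [(w, nat ((int u + s * int (Suc k)) mod int n))]"] conjI) simp_all
  qed
qed

text \<open>The straight walk of length \<open>i\<close> is shortest: since
  \<open>2 * i \<le> n\<close>, no displacement smaller than \<open>i\<close> in absolute value is
  congruent to \<open>i\<close> or \<open>-i\<close> modulo \<open>n\<close>.\<close>

lemma graph_distance_cycle_graph:
  assumes n: "n \<ge> 2" and uv: "u < n" "v < n" and i: "2 * i \<le> n"
    and c: "[int v = int u + int i] (mod int n) \<or> [int v = int u - int i] (mod int n)"
  shows "graph_distance (cycle_graph n) u v = ereal (real i)"
proof -
  interpret pair_graph "cycle_graph n" by (rule pair_graph_cycle_graph) fact
  have cost: "awalk_cost (\<lambda>_. 1) p = real (length p)" for p :: "(nat \<times> nat) list"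
    by (induction p) auto
  obtain s :: int where s: "s = 1 \<or> s = -1" "[int v = int u + s * int i] (mod int n)"
    using c by (metis diff_conv_add_uminus mult_1 mult_minus1)
  have "nat ((int u + s * int i) mod int n) = v"
  proof -
    have "(int u + s * int i) mod int n = int v mod int n" using s(2) by (simp add: cong_def)
    also have "\<dots> = int v" using uv(2) by simp
    finally show ?thesis by simp
  qed
  with cycle_graph_awalk_exists[OF n uv(1) s(1), of i]
  obtain p where p: "awalk u p v" "length p = i" by auto
  have min: "i \<le> length q" if q: "awalk u q v" for q
  proof (rule ccontr)
    assume "\<not> i \<le> length q"
    moreover obtain k :: int where k: "\<bar>k\<bar> \<le> int (length q)" "[int v = int u + k] (mod int n)"
      using cycle_graph_awalk_cong[OF n q] by blast
    ultimately have less: "\<bar>k\<bar> < int i" by simp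
    have "[int u + k = int u + s * int i] (mod int n)"
      using k(2) s(2) cong_sym cong_trans by blast
    then have "[k = s * int i] (mod int n)" by (simp add: cong_add_lcancel)
    then have "int n dvd k - s * int i" by (simp add: cong_iff_dvd_diff)
    \<comment> \<open>From |k| < i the difference is below 2 i, hence below \<open>n\<close>, so
      being a multiple of \<open>n\<close> it vanishes.\<close>
    moreover have "\<bar>k - s * int i\<bar> < int n" using less s(1) i by auto
    ultimately have "k = s * int i" using dvd_imp_le_int[of "k - s * int i" "int n"] by auto
    with less s(1) show False by auto
  qed
  show ?thesis unfolding graph_distance_def \<mu>_def cost
    by (rule INF_eqI) (use p min in auto)
qed

lemma graph_distance_cycle_graph_iff:
  assumes n: "n \<ge> 2" and uv: "u < n" "v < n" and i: "2 * i \<le> n"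
  shows "graph_distance (cycle_graph n) u v = ereal (real i) \<longleftrightarrow>
    [int v = int u + int i] (mod int n) \<or> [int v = int u - int i] (mod int n)"
proof
  assume d: "graph_distance (cycle_graph n) u v = ereal (real i)"
  define r where "r = (int v - int u) mod int n"
  have r: "0 \<le> r" "r < int n" using n by (auto simp: r_def)
  have cr: "[int v = int u + r] (mod int n)"
    by (simp add: r_def cong_def mod_simps)
  have cr': "[int v = int u - (int n - r)] (mod int n)"
    using cr by (auto simp: cong_iff_dvd_diff algebra_simps)
  \<comment> \<open>The shorter way round: \<open>r\<close> steps forward or \<open>n - r\<close>
    steps backward. Its length is the distance by the previous lemma, so it must equal
    \<open>i\<close>.\<close>
  define m where "m = (if 2 * r \<le> int n then nat r else nat (int n - r))"
  have m: "2 * m \<le> n"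
    "[int v = int u + int m] (mod int n) \<or> [int v = int u - int m] (mod int n)"
    using r cr cr' by (auto simp: m_def)
  from graph_distance_cycle_graph[OF n uv m] d have "m = i" by simp
  with m(2) show "[int v = int u + int i] (mod int n) \<or> [int v = int u - int i] (mod int n)"
    by simp
qed (rule graph_distance_cycle_graph[OF assms])

subsection \<open>Singularity as existence of a kernel function\<close>

text \<open>A kernel vector of the adjacency matrix is a function whose values over the neighbours
  of each vertex sum to zero. All later arguments use this form instead of determinants.\<close>

lemma singular_graph_iff:
  fixes G :: "nat pair_pre_digraph"
  assumes "pverts G = {0..<n}"
  shows "singular_graph G \<longleftrightarrow>
    (\<exists>f::nat \<Rightarrow> real. (\<exists>u<n. f u \<noteq> 0) \<and> (\<forall>u<n. (\<Sum>v | v < n \<and> (u, v) \<in> parcs G. f v) = 0))"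
    (is "_ \<longleftrightarrow> ?R")
proof -
  define A where "A = adjacency_matrix G"
  \<comment> \<open>The sorted list of \<open>{0..<n}\<close> is the identity enumeration, so matrix
    indices are the vertices themselves.\<close>
  have A_eq: "A = mat n n (\<lambda>(i, j). if (i, j) \<in> parcs G then 1 else 0)"
    unfolding A_def adjacency_matrix_def assms by (auto simp: Let_def)
  have A: "A \<in> carrier_mat n n" by (simp add: A_eq)
  have row: "(A *\<^sub>v x) $ u = (\<Sum>v | v < n \<and> (u, v) \<in> parcs G. x $ v)"
    if "x \<in> carrier_vec n" "u < n" for x u
  proof -
    have "(A *\<^sub>v x) $ u = (\<Sum>v = 0..<n. (if (u, v) \<in> parcs G then 1 else 0) * x $ v)"
      using that by (simp add: A_eq scalar_prod_def)
    also have "\<dots> = (\<Sum>v \<in> {0..<n} \<inter> {v. (u, v) \<in> parcs G}. x $ v)"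
      by (subst sum.inter_restrict) (auto intro!: sum.cong)
    also have "{0..<n} \<inter> {v. (u, v) \<in> parcs G} = {v. v < n \<and> (u, v) \<in> parcs G}" by auto
    finally show ?thesis .
  qed
  have "singular_graph G \<longleftrightarrow> (\<exists>x. x \<in> carrier_vec n \<and> x \<noteq> 0\<^sub>v n \<and> A *\<^sub>v x = 0\<^sub>v n)"
    using det_0_iff_vec_prod_zero[OF A] by (simp add: singular_graph_def A_def)
  also have "\<dots> \<longleftrightarrow> ?R"
  proof
    assume "\<exists>x. x \<in> carrier_vec n \<and> x \<noteq> 0\<^sub>v n \<and> A *\<^sub>v x = 0\<^sub>v n"
    then obtain x where x: "x \<in> carrier_vec n" "x \<noteq> 0\<^sub>v n" "A *\<^sub>v x = 0\<^sub>v n" by blast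
    have "\<exists>u<n. x $ u \<noteq> 0"
    proof (rule ccontr)
      assume "\<not> (\<exists>u<n. x $ u \<noteq> 0)"
      then have z: "x $ u = 0" if "u < n" for u using that by blast
      have "x = 0\<^sub>v n"
        by (rule eq_vecI) (simp_all add: z carrier_vecD[OF x(1)])
      with x(2) show False ..
    qed
    moreover have "(\<Sum>v | v < n \<and> (u, v) \<in> parcs G. x $ v) = 0" if "u < n" for u
      using row[OF x(1) that] x(3) that by simp
    ultimately show ?R by blast
  next
    assume ?R
    then obtain f :: "nat \<Rightarrow> real" where f': "(\<exists>u<n. f u \<noteq> 0) \<and>
      (\<forall>u<n. (\<Sum>v | v < n \<and> (u, v) \<in> parcs G. f v) = 0)" by (rule exE)
    from f' have f: "\<exists>u<n. f u \<noteq> 0" by (rule conjunct1)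
    from f' have sum0: "(\<Sum>v | v < n \<and> (u, v) \<in> parcs G. f v) = 0" if "u < n" for u
      using that by simp
    define x where "x = vec n f"
    have x: "x \<in> carrier_vec n" by (simp add: x_def)
    have nz: "x \<noteq> 0\<^sub>v n"
    proof
      assume "x = 0\<^sub>v n"
      then have "x $ u = 0" if "u < n" for u using that by simp
      with f show False by (auto simp: x_def)
    qed
    have "A *\<^sub>v x = 0\<^sub>v n"
    proof (rule eq_vecI)
      fix u assume "u < dim_vec (0\<^sub>v n :: real vec)"
      then have u: "u < n" by simp
      have "(\<Sum>v | v < n \<and> (u, v) \<in> parcs G. x $ v) = (\<Sum>v | v < n \<and> (u, v) \<in> parcs G. f v)"
        by (intro sum.cong) (auto simp: x_def)
      with row[OF x u] sum0[OF u] u show "(A *\<^sub>v x) $ u = 0\<^sub>v n $ u" by simp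
    qed (simp add: A_eq)
    with x nz show "\<exists>x. x \<in> carrier_vec n \<and> x \<noteq> 0\<^sub>v n \<and> A *\<^sub>v x = 0\<^sub>v n" by blast
  qed
  finally show ?thesis .
qed

text \<open>In the complement, \<open>u\<close> is adjacent to all vertices except \<open>u\<close>,
  \<open>u + i\<close> and \<open>u - i\<close> modulo \<open>n\<close>, so each row sum is the
  total minus the values there. Periodic functions on the integers make reductions of indices
  unnecessary.\<close>

lemma singular_complement_distance_cycle_graph_iff:
  fixes n i :: nat
  assumes n: "n \<ge> 2" and i: "1 \<le> i" "2 * i \<le> n"
  shows "singular_graph (graph_complement (distance_graph (cycle_graph n) i)) \<longleftrightarrow>
    (\<exists>f::int \<Rightarrow> real. (\<forall>x. f (x mod int n) = f x) \<and> (\<exists>x. f x \<noteq> 0) \<and>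
       (\<forall>x. (\<Sum>y\<in>{0..<int n}. f y) = f x + f (x + int i) + (if 2 * i = n then 0 else f (x - int i))))"
    (is "singular_graph ?G \<longleftrightarrow> (\<exists>f. ?P f)")
proof -
  have verts: "pverts ?G = {0..<n}"
    by (simp add: graph_complement_def distance_graph_def cycle_graph_def)
  have arcs: "(u, v) \<in> parcs ?G \<longleftrightarrow> u \<noteq> v \<and>
      \<not> ([int v = int u + int i] (mod int n) \<or> [int v = int u - int i] (mod int n))"
    if "u < n" "v < n" for u v
    using that graph_distance_cycle_graph_iff[OF n that i(2)]
    by (auto simp: graph_complement_def distance_graph_def cycle_graph_def)
  have row: "(\<Sum>v | v < n \<and> (u, v) \<in> parcs ?G. f (int v)) =
      (\<Sum>y\<in>{0..<int n}. f y) - (f (int u) + f (int u + int i) +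
        (if 2 * i = n then 0 else f (int u - int i)))"
    if per: "\<And>x. f (x mod int n) = f x" and u: "u < n" for f :: "int \<Rightarrow> real" and u
  proof -
    define a b where "a = (int u + int i) mod int n" and "b = (int u - int i) mod int n"
    have ab: "a \<in> {0..<int n}" "b \<in> {0..<int n}" using n by (auto simp: a_def b_def)
    have dvd: "\<not> int n dvd d" if "0 < d" "d < int n" for d
      using that zdvd_not_zless by blast
    \<comment> \<open>Each removed vertex must be counted once: \<open>u\<close> differs from
      \<open>a\<close> and \<open>b\<close> because 0 < i < n, and \<open>a = b\<close> happens only
      for 2 i = n because 0 < 2 i \<le> n.\<close>
    have ua: "int u \<noteq> a"
    proof
      assume "int u = a"
      then have "int u mod int n = (int u + int i) mod int n" using u a_def by simp
      then have "int n dvd int i" by (simp add: mod_eq_dvd_iff)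
      with dvd[of "int i"] i n show False by auto
    qed
    have ub: "int u \<noteq> b"
    proof
      assume "int u = b"
      then have "int u mod int n = (int u - int i) mod int n" using u b_def by simp
      then have "int n dvd int i" by (simp add: mod_eq_dvd_iff)
      with dvd[of "int i"] i n show False by auto
    qed
    have eq: "a = b \<longleftrightarrow> 2 * i = n"
    proof -
      have "a = b \<longleftrightarrow> int n dvd 2 * int i"
        by (simp add: a_def b_def mod_eq_dvd_iff)
      also have "\<dots> \<longleftrightarrow> 2 * i = n" using dvd[of "2 * int i"] i by (cases "2 * i = n") auto
      finally show ?thesis .
    qed
    have "(\<Sum>v | v < n \<and> (u, v) \<in> parcs ?G. f (int v)) =
        (\<Sum>y \<in> int ` {v. v < n \<and> (u, v) \<in> parcs ?G}. f y)"
      by (simp add: sum.reindex)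
    also have "int ` {v. v < n \<and> (u, v) \<in> parcs ?G} = {0..<int n} - {int u, a, b}"
      (is "?L = ?R")
    proof (rule Set.set_eqI)
      fix y
      show "y \<in> ?L \<longleftrightarrow> y \<in> ?R"
      proof (cases "0 \<le> y \<and> y < int n")
        case True
        then obtain v where v: "y = int v" "v < n"
          by (metis nonneg_int_cases of_nat_less_iff)
        have "y \<in> ?L \<longleftrightarrow> (u, v) \<in> parcs ?G" using v by auto
        also have "\<dots> \<longleftrightarrow> y \<in> ?R"
          using v u by (simp add: arcs[OF u v(2)] cong_def a_def b_def) auto
        finally show ?thesis .
      qed auto
    qed
    also have "(\<Sum>y\<in>{0..<int n} - {int u, a, b}. f y) =
        (\<Sum>y\<in>{0..<int n}. f y) - (\<Sum>y\<in>{int u, a, b}. f y)"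
      using ab u by (intro sum_diff) auto
    also have "(\<Sum>y\<in>{int u, a, b}. f y) = f (int u) + f (int u + int i) +
        (if 2 * i = n then 0 else f (int u - int i))"
    proof -
      have "f a = f (int u + int i)" "f b = f (int u - int i)"
        by (simp_all add: a_def b_def per)
      then show ?thesis using ua ub eq by auto
    qed
    finally show ?thesis .
  qed
  show ?thesis
  proof
    assume "singular_graph ?G"
    then obtain h :: "nat \<Rightarrow> real" where h: "\<exists>u<n. h u \<noteq> 0"
      "\<And>u. u < n \<Longrightarrow> (\<Sum>v | v < n \<and> (u, v) \<in> parcs ?G. h v) = 0"
      using singular_graph_iff[OF verts] by blast
    define f :: "int \<Rightarrow> real" where "f x = h (nat (x mod int n))" for x
    have per: "f (x mod int n) = f x" for x by (simp add: f_def)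
    have fh: "f (int v) = h v" if "v < n" for v using that by (simp add: f_def)
    have "(\<Sum>y\<in>{0..<int n}. f y) = f x + f (x + int i) + (if 2 * i = n then 0 else f (x - int i))" for x
    proof -
      define u where "u = nat (x mod int n)"
      have iu: "int u = x mod int n" and u: "u < n" using n by (auto simp: u_def nat_less_iff)
      have "(\<Sum>v | v < n \<and> (u, v) \<in> parcs ?G. f (int v)) =
          (\<Sum>v | v < n \<and> (u, v) \<in> parcs ?G. h v)"
        by (intro sum.cong) (auto simp: fh)
      with row[of f u, OF per u] h(2)[OF u]
      have "(\<Sum>y\<in>{0..<int n}. f y) = f (int u) + f (int u + int i) +
          (if 2 * i = n then 0 else f (int u - int i))" by simp
      moreover have "f (int u + int i) = f (x + int i)" "f (int u - int i) = f (x - int i)"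
        "f (int u) = f x"
        by (simp_all add: f_def iu mod_simps)
      ultimately show ?thesis by simp
    qed
    moreover have "\<exists>x. f x \<noteq> 0" using h(1) fh by metis
    ultimately show "\<exists>f. ?P f" using per by blast
  next
    assume "\<exists>f. ?P f"
    then obtain f where f: "?P f" by blast
    then have per: "\<And>x. f (x mod int n) = f x" by blast
    obtain x where x: "f x \<noteq> 0" using f by blast
    \<comment> \<open>The nonzero value may lie outside the period \<open>{0..<n}\<close>;
      periodicity moves it to a vertex.\<close>
    have "nat (x mod int n) < n" "f (int (nat (x mod int n))) \<noteq> 0"
      using n x per by (auto simp: nat_less_iff)
    then have "\<exists>u<n. f (int u) \<noteq> 0" by blast
    moreover have "(\<Sum>v | v < n \<and> (u, v) \<in> parcs ?G. f (int v)) = 0" if "u < n" for u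
    proof -
      have "(\<Sum>y\<in>{0..<int n}. f y) = f (int u) + f (int u + int i) +
          (if 2 * i = n then 0 else f (int u - int i))" using f by blast
      then show ?thesis using row[of f u, OF per that] by linarith
    qed
    ultimately show "singular_graph ?G" unfolding singular_graph_iff[OF verts]
      by (intro exI[of _ "\<lambda>u. f (int u)"] conjI allI impI)
  qed
qed

subsection \<open>Solving the recurrence\<close>

text \<open>Negative multiples are included because the Bezout coefficients used below can have
  either sign.\<close>

lemma periodic_int_mult:
  fixes f :: "int \<Rightarrow> 'a"
  assumes "\<And>x. f (x + p) = f x"
  shows "f (x + k * p) = f x"
proof (induction k arbitrary: x rule: int_induct[of _ 0])
  case (step1 k)
  have "x + (k + 1) * p = (x + k * p) + p" by (simp add: algebra_simps)
  then show ?case using assms step1 by metis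
next
  case (step2 k)
  have "x + k * p = (x + (k - 1) * p) + p" by (simp add: algebra_simps)
  then show ?case using assms step2 by metis
qed simp

text \<open>Adding \<open>c\<close> permutes the residues modulo \<open>m\<close>. Hence each
  shifted term of the kernel equation has the same sum over a period.\<close>

lemma sum_periodic_shift:
  fixes f :: "int \<Rightarrow> 'a::comm_monoid_add"
  assumes "m > 0" and per: "\<And>x. f (x mod m) = f x"
  shows "(\<Sum>y\<in>{0..<m}. f (y + c)) = (\<Sum>y\<in>{0..<m}. f y)"
  by (rule sum.reindex_bij_witness[of _ "\<lambda>y. (y - c) mod m" "\<lambda>y. (y + c) mod m"])
     (use assms in \<open>auto simp: mod_simps\<close>)

lemma singular_complement_distance_cycle_graph:
  fixes n i :: nat
  assumes n: "n \<ge> 4" and i: "1 \<le> i" "2 * i < n"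
  shows "singular_graph (graph_complement (distance_graph (cycle_graph n) i))
    \<longleftrightarrow> 3 * gcd i n dvd n"
proof -
  define g where "g = gcd (int i) (int n)"
  have g: "g > 0" "g dvd int i" "g dvd int n" using i by (auto simp: g_def)
  have gn: "3 * gcd i n dvd n \<longleftrightarrow> 3 * g dvd int n"
    by (simp add: g_def flip: int_dvd_int_iff)
  \<comment> \<open>Since 2 i < n, the shifts by \<open>i\<close> and \<open>-i\<close> are distinct
    modulo \<open>n\<close>, and all three terms remain.\<close>
  have kernel: "singular_graph (graph_complement (distance_graph (cycle_graph n) i)) \<longleftrightarrow>
    (\<exists>f::int \<Rightarrow> real. (\<forall>x. f (x mod int n) = f x) \<and> (\<exists>x. f x \<noteq> 0) \<and>
       (\<forall>x. (\<Sum>y\<in>{0..<int n}. f y) = f x + f (x + int i) + f (x - int i)))"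
    using singular_complement_distance_cycle_graph_iff[of n i] n i by simp
  have sums: "(\<Sum>x\<in>{0..<int n}. f x + f (x + int i) + f (x - int i)) =
      3 * (\<Sum>y\<in>{0..<int n}. f y)"
    if "\<And>x. f (x mod int n) = f x" for f :: "int \<Rightarrow> real"
    using sum_periodic_shift[of "int n" f, OF _ that, of "int i"]
      sum_periodic_shift[of "int n" f, OF _ that, of "- int i"] n
    by (simp add: sum.distrib)
  show ?thesis unfolding kernel gn
  proof
    assume "\<exists>f::int \<Rightarrow> real. (\<forall>x. f (x mod int n) = f x) \<and> (\<exists>x. f x \<noteq> 0) \<and>
       (\<forall>x. (\<Sum>y\<in>{0..<int n}. f y) = f x + f (x + int i) + f (x - int i))"
    then obtain f :: "int \<Rightarrow> real" where per: "\<And>x. f (x mod int n) = f x"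
      and nz: "\<exists>x. f x \<noteq> 0"
      and rec: "\<And>x. (\<Sum>y\<in>{0..<int n}. f y) = f x + f (x + int i) + f (x - int i)" by blast
    have "real n * (\<Sum>y\<in>{0..<int n}. f y) = 3 * (\<Sum>y\<in>{0..<int n}. f y)"
      using sums[of f, OF per] unfolding rec[symmetric] by simp
    \<comment> \<open>Here \<open>n \<ge> 4\<close> excludes \<open>n = 3\<close>, where the factors
      \<open>n\<close> and 3 would agree.\<close>
    then have zero: "(\<Sum>y\<in>{0..<int n}. f y) = 0" using n by simp
    have pn: "f (x + int n) = f x" for x by (metis per mod_add_self2)
    \<comment> \<open>The equations centred at \<open>x + i\<close> and \<open>x + 2 i\<close> share
      two terms; subtracting them leaves \<open>f (x + 3 i) = f x\<close>.\<close>
    have p3: "f (x + 3 * int i) = f x" for x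
      using rec[of "x + int i"] rec[of "x + 2 * int i"] zero
      by (simp add: algebra_simps)
    show "3 * g dvd int n"
    proof (rule ccontr)
      assume no: "\<not> 3 * g dvd int n"
      \<comment> \<open>With i = g j and n = g m, the assumption says that 3 does not divide
        \<open>m\<close>. So the factor 3 cancels in \<open>gcd (3 * j) m\<close>, leaving
        \<open>g * gcd j m\<close>, a divisor of \<open>i\<close>.\<close>
      have "gcd (3 * int i) (int n) dvd int i"
      proof -
        obtain m where m: "int n = g * m" using g(3) by blast
        obtain j where j: "int i = g * j" using g(2) by blast
        have "\<not> 3 dvd m" using no m by auto
        then have "coprime 3 m" by (simp add: prime_imp_coprime)
        then have "gcd (3 * j) m = gcd j m" 
          by (simp add: gcd_mult_left_left_cancel coprime_commute)
        then have "gcd (3 * int i) (int n) = g * gcd j m" using g(1)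
          by (simp add: m j gcd_mult_left mult.left_commute[of 3] )
        then show ?thesis by (simp add: j)
      qed
      then obtain c where c: "int i = gcd (3 * int i) (int n) * c" by blast
      obtain a b where ab: "a * (3 * int i) + b * int n = gcd (3 * int i) (int n)"
        using bezout_int by blast
      \<comment> \<open>Scaling the Bezout identity by \<open>c\<close> writes \<open>i\<close> as
        an integer combination of the periods \<open>3 i\<close> and \<open>n\<close>, so
        \<open>i\<close> is itself a period.\<close>
      have "c * (a * (3 * int i) + b * int n) = int i"
        unfolding ab by (subst (2) c) simp
      then have i_eq: "int i = (c * a) * (3 * int i) + (c * b) * int n"
        by (simp add: algebra_simps)
      have pi: "f (x + int i) = f x" for x
      proof -
        have "f (x + int i) = f ((x + (c * a) * (3 * int i)) + (c * b) * int n)"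
          using i_eq by (simp only: add.assoc)
        also have "\<dots> = f (x + (c * a) * (3 * int i))"
          by (rule periodic_int_mult) (rule pn)
        also have "\<dots> = f x"
          by (rule periodic_int_mult) (rule p3)
        finally show ?thesis .
      qed
      have "f x = 0" for x using rec[of x] zero pi[of x] pi[of "x - int i"] by simp
      with nz show False by blast
    qed
  next
    assume d: "3 * g dvd int n"
    define f :: "int \<Rightarrow> real" where
      "f x = (if x mod (3 * g) = 0 then 1 else if x mod (3 * g) = g then -1 else 0)" for x
    have per: "f (x mod int n) = f x" for x
      using d by (simp add: f_def mod_mod_cancel)
    have "f 0 \<noteq> 0" by (simp add: f_def)
    have fmod: "f x = f y" if "3 * g dvd x - y" for x y
    proof -
      have "x mod (3 * g) = y mod (3 * g)" using that by (simp only: mod_eq_dvd_iff)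
      then show ?thesis by (simp add: f_def)
    qed
    \<comment> \<open>Along steps of \<open>g\<close> the values of \<open>f\<close> repeat with
      period three. Writing x = t + g q with t = x mod g, the residue of \<open>q\<close> modulo 3
      merely rotates the triple in \<open>base\<close>.\<close>
    have cyc: "f x + f (x + g) + f (x - g) = 0" for x
    proof -
      define t where "t = x mod g"
      have t: "0 \<le> t" "t < g" using g(1) by (auto simp: t_def)
      \<comment> \<open>For \<open>t = 0\<close> the terms are 1, -1 and 0; for 0 < t < g no
        argument is congruent to 0 or \<open>g\<close> modulo \<open>3 g\<close>, so all
        vanish.\<close>
      have base: "f t + f (t + g) + f (t + 2 * g) = 0"
        using t by (simp add: f_def)
      have x: "x = t + g * (x div g)" by (simp add: t_def)
      define k where "k = x div g div 3"
      have "y = 3 * (y div 3) \<or> y = 3 * (y div 3) + 1 \<or> y = 3 * (y div 3) + 2" for y :: int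
        by presburger
      then have "x div g = 3 * k \<or> x div g = 3 * k + 1 \<or> x div g = 3 * k + 2"
        unfolding k_def by blast
      then consider "x = t + 3 * g * k" | "x = t + g + 3 * g * k" | "x = t + 2 * g + 3 * g * k"
        using x by (auto simp: algebra_simps)
      then show ?thesis
      proof cases
        case 1
        then have "f x = f t" "f (x + g) = f (t + g)" by (auto intro!: fmod)
        \<comment> \<open>Stepping back from \<open>t\<close> wraps around to \<open>t + 2 g\<close>
          one block of length \<open>3 g\<close> earlier, hence the witness
          \<open>k - 1\<close>.\<close>
        moreover have "f (x - g) = f (t + 2 * g)"
          by (rule fmod, rule dvdI[of _ _ "k - 1"]) (simp add: 1 algebra_simps)
        ultimately show ?thesis using base by simp
      next
        case 2
        then have "f x = f (t + g)" "f (x + g) = f (t + 2 * g)" "f (x - g) = f t"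
          by (auto intro!: fmod)
        then show ?thesis using base by simp
      next
        case 3
        then have "f x = f (t + 2 * g)" "f (x - g) = f (t + g)" by (auto intro!: fmod)
        moreover have "f (x + g) = f t"
          by (rule fmod, rule dvdI[of _ _ "k + 1"]) (simp add: 3 algebra_simps)
        ultimately show ?thesis using base by simp
      qed
    qed
    obtain j where j: "int i = g * j" using g(2) by blast
    \<comment> \<open>Otherwise \<open>3 g\<close> would divide both \<open>i\<close> and
      \<open>n\<close>, hence their gcd \<open>g\<close>.\<close>
    have "\<not> 3 dvd j"
    proof
      assume "3 dvd j"
      then have "3 * g dvd int i" by (auto simp: j)
      then have "3 * g dvd gcd (int i) (int n)" using d by (rule gcd_greatest)
      then have "3 * g dvd g" by (simp only: g_def)
      with g(1) show False by (auto dest: zdvd_imp_le)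
    qed
    have rec: "f x + f (x + int i) + f (x - int i) = 0" for x
    proof -
      \<comment> \<open>So \<open>i\<close> is congruent to \<open>g\<close> or \<open>-g\<close>
        modulo \<open>3 g\<close>, and the shifts by \<open>i\<close> and \<open>-i\<close> agree
        with those by \<open>g\<close> and \<open>-g\<close>, possibly swapped.\<close>
      have "3 dvd j - 1 \<or> 3 dvd j + 1" using \<open>\<not> 3 dvd j\<close> by presburger
      then show ?thesis
      proof
        assume "3 dvd j - 1"
        then have "g * 3 dvd g * (j - 1)" by (rule mult_dvd_mono[OF dvd_refl])
        then have *: "3 * g dvd int i - g" by (simp add: j algebra_simps)
        have "f (x + int i) = f (x + g)" by (rule fmod) (use * in simp)
        moreover have "f (x - g) = f (x - int i)" by (rule fmod) (use * in simp)
        ultimately show ?thesis using cyc[of x] by simp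
      next
        assume "3 dvd j + 1"
        then have "g * 3 dvd g * (j + 1)" by (rule mult_dvd_mono[OF dvd_refl])
        then have *: "3 * g dvd int i + g" by (simp add: j algebra_simps)
        have "f (x + int i) = f (x - g)" by (rule fmod) (use * in simp)
        moreover have "f (x + g) = f (x - int i)" by (rule fmod) (use * in \<open>simp add: add.commute\<close>)
        ultimately show ?thesis using cyc[of x] by simp
      qed
    qed
    have "(\<Sum>y\<in>{0..<int n}. f y) = 0" using sums[of f, OF per] unfolding rec by simp
    with per rec \<open>f 0 \<noteq> 0\<close>
    show "\<exists>f::int \<Rightarrow> real. (\<forall>x. f (x mod int n) = f x) \<and> (\<exists>x. f x \<noteq> 0) \<and>
       (\<forall>x. (\<Sum>y\<in>{0..<int n}. f y) = f x + f (x + int i) + f (x - int i))"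
      by (intro exI[of _ f]) auto
  qed
qed

section \<open>The antipodal case 2 i = n and the final case distinction\<close>

lemma singular_complement_antipodal_cycle_graph:
  assumes "n \<ge> 2" "2 * i = n"
  shows "singular_graph (graph_complement (distance_graph (cycle_graph n) i))"
proof -
  \<comment> \<open>The removed edges form a perfect matching, so the vertices 0 and
    \<open>i\<close> have the same neighbours in the complement. The function \<open>f\<close> is
    the difference of their indicators.\<close>
  define f :: "int \<Rightarrow> real" where
    "f x = (if x mod int n = 0 then 1 else if x mod int n = int i then -1 else 0)" for x
  have n: "int n = 2 * int i" and i: "i \<ge> 1" using assms by auto
  have per: "f (x mod int n) = f x" for x by (simp add: f_def)
  have rec: "f x + f (x + int i) = 0" for x
  proof -
    define t where "t = x mod int n"
    have t: "0 \<le> t" "t < 2 * int i" using n i by (auto simp: t_def)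
    have "(x + int i) mod int n = (t + int i) mod int n" by (simp add: t_def mod_simps)
    \<comment> \<open>Adding \<open>i\<close> modulo 2 i exchanges the two halves of the
      period.\<close>
    also have "\<dots> = (if t < int i then t + int i else t - int i)"
    proof (cases "t < int i")
      case False
      have "(t + int i) mod int n = (t - int i + int n) mod int n" by (simp add: n add.commute)
      also have "\<dots> = t - int i" unfolding mod_add_self2 using False t n by simp
      finally show ?thesis using False by simp
    qed (use t n in simp)
    finally show ?thesis using t by (auto simp: f_def t_def[symmetric])
  qed
  have sum0: "(\<Sum>y\<in>{0..<int n}. f y) = 0"
  proof -
    \<comment> \<open>Pairing each \<open>y\<close> with its antipode counts the total twice, and
      every pair cancels.\<close>
    have "2 * (\<Sum>y\<in>{0..<int n}. f y) = (\<Sum>y\<in>{0..<int n}. f y + f (y + int i))"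
      using sum_periodic_shift[of "int n" f, OF _ per, of "int i"] assms
      by (simp add: sum.distrib)
    then show ?thesis by (simp add: rec)
  qed
  have "f 0 \<noteq> 0" by (simp add: f_def)
  then show ?thesis
    using assms i per rec sum0
    by (subst singular_complement_distance_cycle_graph_iff) (auto intro!: exI[of _ f])
qed

theorem lemma15:
  fixes n \<tau> :: nat
  assumes "n \<ge> 4" and "\<tau> = n div 2"
  shows
    "(singular_graph (graph_complement (distance_graph (cycle_graph n) \<tau>))
        \<longleftrightarrow> even n \<or> n mod 6 = 3) \<and>
     (\<forall>i::nat. 1 \<le> i \<and> i < \<tau> \<longrightarrow>
        (singular_graph (graph_complement (distance_graph (cycle_graph n) i))
          \<longleftrightarrow> 3 dvd n \<and> gcd i n dvd n div 3))"
proof (intro conjI allI impI)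
  show "singular_graph (graph_complement (distance_graph (cycle_graph n) \<tau>))
      \<longleftrightarrow> even n \<or> n mod 6 = 3"
  proof (cases "even n")
    case True
    then show ?thesis using singular_complement_antipodal_cycle_graph[of n \<tau>] assms by simp
  next
    case False
    \<comment> \<open>For odd \<open>n\<close> the number \<open>\<tau>\<close> is coprime to
      \<open>n\<close>, so the divisibility condition reduces to \<open>3 dvd n\<close>; for odd
      numbers this means residue 3 modulo 6.\<close>
    then have n: "n = 2 * \<tau> + 1" using assms(2) by presburger
    then have "gcd \<tau> n = 1"  using gcd_add_mult[of \<tau> 2 1] by simp
    moreover have "3 dvd n \<longleftrightarrow> n mod 6 = 3" using False by presburger
    ultimately show ?thesis
      using False n singular_complement_distance_cycle_graph[of n \<tau>] assms(1) by simp
  qed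
next
  fix i assume i: "1 \<le> i \<and> i < \<tau>"
  \<comment> \<open>The truncating division is exact here, since \<open>3 dvd n\<close> is part of
    the right-hand side and follows from the left.\<close>
  have "3 * gcd i n dvd n \<longleftrightarrow> 3 dvd n \<and> gcd i n dvd n div 3"
    by (metis dvd_div_iff_mult dvd_mult_left mult.commute zero_neq_numeral)
  then show "singular_graph (graph_complement (distance_graph (cycle_graph n) i))
      \<longleftrightarrow> 3 dvd n \<and> gcd i n dvd n div 3"
    using singular_complement_distance_cycle_graph[of n i] assms i by linarith
qed

end
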